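(* Let $A$ be a perfect object of $\mathbf{rGr}^{\bullet}$ with $\mathsf{wStab}(A)=0$ (i.e. $\mathsf{wStab}(A)=\{0\}$). Then the set $\mathsf{Pentact}(A)$ of all pentactions of $A$, with the addition $(\mathbf{b},\mathbf{b}')\mapsto \mathbf{b}+\mathbf{b}'$ and the action operation $(\mathbf{b},\mathbf{b}')\mapsto \mathbf{b}^{\mathbf{b}'}$, is an object of $\mathbf{rGr}^{\bullet}$.
   Context: **Reduced groups with action.** A group with action is a group $G$ (written additively, not assumed commutative) with a map $G\times G\to G$, $(g,h)\mapsto g^{h}$, such that $(g+g')^{h}=g^{h}+g'^{h}$, $g^{h+h'}=(g^{h})^{h'}$, $g^{0}=g$ for all $g,g',h,h'\in G$. Morphisms are group homomorphisms $\alpha$ with $\alpha(g^{h})=\alpha(g)^{\alpha(h)}$. The category $\mathbf{rGr}^{\bullet}$ of reduced groups with action is the full subcategory of those $G$ such that for all $x,y,z\in G$: $x^{y}+z=z+x^{y}$ whenever $y\neq 0$, and $x^{(y^{z})}=x^{y}$. **Perfect.** $A\in\mathbf{rGr}^{\bullet}$ is perfect if $A^{A}=A$, where $A^{A}$ is the subobject of $A$ (subgroup closed under the action operation) generated by the elements $a^{a'}$, $a,a'\in A$. **Pentactions.** Let $A\in\mathbf{rGr}^{\bullet}$. Consider a quintuple $\mathbf{b}$ of functions $A\to A$ whose values at $a\in A$ are denoted respectively $b\cdot a,\ a\cdot b,\ a^{b},\ {}^{b}a,\ b^{a}$ (here $b$ is only a symbol indexing the quintuple). For $x,a\in A$ put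 ${}^{x}a:=a^{-x}$. The quintuple $\mathbf{b}$ is a pentaction of $A$ if for all $a,a'\in A$: 1. $b\cdot(a+a')=b\cdot a+b\cdot a'$; 1°. $(a+a')\cdot b=a\cdot b+a'\cdot b$; 2. $(a+a')^{b}=a^{b}+a'^{b}$; 2°. ${}^{b}(a+a')={}^{b}a+{}^{b}a'$; 3. $(b\cdot a)^{a'}=a^{a'}$ if $a'\neq0$; 3°. $(a\cdot b)^{a'}=a^{a'}$ if $a'\ne 0$; 4. $b^{(a+a')}=(b^{a})^{a'}+b^{a'}$; 5. $(a^{b\cdot a'})^{b}=(a^{b})^{a'}$; 5°. ${}^{b}({}^{a'\cdot b}a)={}^{a'}({}^{b}a)$; 6. $b\cdot a^{a'}=a^{a'}$ if $a'\neq 0$; 6°. $a^{a'}\cdot b=a^{a'}$ if $a'\ne0$; 7. $b^{(a^{a'})}=b^{a}$; 8. $a^{b}+a'=a'+a^{b}$ for all $a,a'$, provided $x^{b}\neq x$ for at least one $x\in A$; 8°. ${}^{b}a+a'=a'+{}^{b}a$ for all $a,a'$, provided ${}^{b}x\neq x$ for at least one $x\in A$; 9. $a^{(a'^{b})}=a^{a'}$; 9°. $a^{({}^{b}a')}=a^{a'}$; 10. $a^{(b^{a'})}=a$ if $a'\neq0$; 11. $(b\cdot a)\cdot b=b\cdot(a\cdot b)=a$; 12. ${}^{b}(a^{b})=({}^{b}a)^{b}=a$. $\mathsf{Pentact}(A)$ is the set of all pentactions of $A$. **Operations.** For pentactions $\mathbf{b},\mathbf{b}'$ of $A$ the quintuple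 $\mathbf{b}+\mathbf{b}'$ is defined by $(b+b')\cdot a=b\cdot(b'\cdot a)$, $a\cdot(b+b')=(a\cdot b)\cdot b'$, $a^{(b+b')}=(a^{b})^{b'}$, ${}^{(b+b')}a={}^{b}({}^{b'}a)$, $(b+b')^{a}=b^{a}+b\cdot(b'^{a})$; and the quintuple $\mathbf{b}^{\mathbf{b}'}$ is defined by $(b^{b'})\cdot a=a$, $a\cdot(b^{b'})=a$, $a^{(b^{b'})}=a^{b}$, ${}^{(b^{b'})}a={}^{b}a$, $(b^{b'})^{a}=(b^{(b'\cdot a)})^{b'}$. The zero pentaction $\mathbf{0}$ is given by $0\cdot a=a\cdot 0=a^{0}={}^{0}a=a$, $0^{a}=0$. **Weak stabilizer.** $\mathsf{wStab}(A)$ is the set of all elements of $A$ of the forms $b^{(b'^{a})}$, $\ b^{(a^{b'})}-b^{a}$, $\ a^{b+b'}-a^{b'+b}$, where $a\in A$ and $\mathbf{b},\mathbf{b}'\in\mathsf{Pentact}(A)$. *)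

theory Defs
  imports "HOL-Algebra.Group"
begin

text \<open>
  The additively written, not necessarily commutative groups of the source are groups in the sense
  of HOL-Algebra, hence multiplicative here: sum, zero and negative are \<open>\<otimes>\<close>, \<open>\<one>\<close> and \<open>inv\<close>.
  The action of \<open>h\<close> on \<open>g\<close>, written \<open>g\<close> to the power \<open>h\<close> in the source, is \<open>g \<star> h\<close>.
\<close>

record 'a gact = "'a monoid" +
  act :: "'a \<Rightarrow> 'a \<Rightarrow> 'a"  (infixl \<open>\<star>\<index>\<close> 75)

locale group_with_action = group G for G :: "('a, 'm) gact_scheme" (structure) +
  assumes act_closed: "\<lbrakk>g \<in> carrier G; h \<in> carrier G\<rbrakk> \<Longrightarrow> g \<star> h \<in> carrier G"
    and act_mult: "\<lbrakk>g \<in> carrier G; g' \<in> carrier G; h \<in> carrier G\<rbrakk>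
          \<Longrightarrow> (g \<otimes> g') \<star> h = (g \<star> h) \<otimes> (g' \<star> h)"
    and act_act: "\<lbrakk>g \<in> carrier G; h \<in> carrier G; h' \<in> carrier G\<rbrakk>
          \<Longrightarrow> g \<star> (h \<otimes> h') = (g \<star> h) \<star> h'"
    and act_one: "g \<in> carrier G \<Longrightarrow> g \<star> \<one> = g"

locale reduced_group_with_action = group_with_action +
  assumes act_central: "\<lbrakk>x \<in> carrier G; y \<in> carrier G; z \<in> carrier G; y \<noteq> \<one>\<rbrakk>
          \<Longrightarrow> (x \<star> y) \<otimes> z = z \<otimes> (x \<star> y)"
    and act_reduced: "\<lbrakk>x \<in> carrier G; y \<in> carrier G; z \<in> carrier G\<rbrakk>
          \<Longrightarrow> x \<star> (y \<star> z) = x \<star> y"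

definition act_subobject :: "'a set \<Rightarrow> ('a, 'm) gact_scheme \<Rightarrow> bool" where
  "act_subobject H G \<longleftrightarrow> subgroup H G \<and> (\<forall>h\<in>H. \<forall>h'\<in>H. h \<star>\<^bsub>G\<^esub> h' \<in> H)"

definition act_generate :: "('a, 'm) gact_scheme \<Rightarrow> 'a set \<Rightarrow> 'a set" where
  "act_generate G S = \<Inter>{H. act_subobject H G \<and> S \<subseteq> H}"

definition perfect :: "('a, 'm) gact_scheme \<Rightarrow> bool" where
  "perfect A \<longleftrightarrow>
     act_generate A {a \<star>\<^bsub>A\<^esub> a' | a a'. a \<in> carrier A \<and> a' \<in> carrier A} = carrier A"

text \<open>
  A quintuple of functions; the comments give the notation of the source for the value at \<open>a\<close>.
\<close>

record 'a quintuple =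
  ldot :: "'a \<Rightarrow> 'a"  (* b . a *)
  rdot :: "'a \<Rightarrow> 'a"  (* a . b *)
  rexp :: "'a \<Rightarrow> 'a"  (* a to the right exponent b *)
  lexp :: "'a \<Rightarrow> 'a"  (* a to the left exponent b *)
  bexp :: "'a \<Rightarrow> 'a"  (* b to the right exponent a *)

text \<open>
  The functions are extensional (\<open>undefined\<close> outside the carrier), so that equality of quintuples
  is equality of functions on the carrier.  An element \<open>x\<close> as a left exponent of \<open>a\<close> is, by
  convention, \<open>a \<star> inv x\<close>.
\<close>

locale pentaction =
  fixes A :: "('a, 'm) gact_scheme" (structure) and b :: "'a quintuple"
  assumes ldot_fun: "ldot b \<in> carrier A \<rightarrow>\<^sub>E carrier A"
    and rdot_fun: "rdot b \<in> carrier A \<rightarrow>\<^sub>E carrier A"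
    and rexp_fun: "rexp b \<in> carrier A \<rightarrow>\<^sub>E carrier A"
    and lexp_fun: "lexp b \<in> carrier A \<rightarrow>\<^sub>E carrier A"
    and bexp_fun: "bexp b \<in> carrier A \<rightarrow>\<^sub>E carrier A"
    and pent1: "\<lbrakk>a \<in> carrier A; a' \<in> carrier A\<rbrakk> \<Longrightarrow> ldot b (a \<otimes> a') = ldot b a \<otimes> ldot b a'"
    and pent1': "\<lbrakk>a \<in> carrier A; a' \<in> carrier A\<rbrakk> \<Longrightarrow> rdot b (a \<otimes> a') = rdot b a \<otimes> rdot b a'"
    and pent2: "\<lbrakk>a \<in> carrier A; a' \<in> carrier A\<rbrakk> \<Longrightarrow> rexp b (a \<otimes> a') = rexp b a \<otimes> rexp b a'"
    and pent2': "\<lbrakk>a \<in> carrier A; a' \<in> carrier A\<rbrakk> \<Longrightarrow> lexp b (a \<otimes> a') = lexp b a \<otimes> lexp b a'"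
    and pent3: "\<lbrakk>a \<in> carrier A; a' \<in> carrier A; a' \<noteq> \<one>\<rbrakk> \<Longrightarrow> ldot b a \<star> a' = a \<star> a'"
    and pent3': "\<lbrakk>a \<in> carrier A; a' \<in> carrier A; a' \<noteq> \<one>\<rbrakk> \<Longrightarrow> rdot b a \<star> a' = a \<star> a'"
    and pent4: "\<lbrakk>a \<in> carrier A; a' \<in> carrier A\<rbrakk>
          \<Longrightarrow> bexp b (a \<otimes> a') = (bexp b a \<star> a') \<otimes> bexp b a'"
    and pent5: "\<lbrakk>a \<in> carrier A; a' \<in> carrier A\<rbrakk>
          \<Longrightarrow> rexp b (a \<star> ldot b a') = rexp b a \<star> a'"
    and pent5': "\<lbrakk>a \<in> carrier A; a' \<in> carrier A\<rbrakk>
          \<Longrightarrow> lexp b (a \<star> inv (rdot b a')) = lexp b a \<star> inv a'"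
    and pent6: "\<lbrakk>a \<in> carrier A; a' \<in> carrier A; a' \<noteq> \<one>\<rbrakk> \<Longrightarrow> ldot b (a \<star> a') = a \<star> a'"
    and pent6': "\<lbrakk>a \<in> carrier A; a' \<in> carrier A; a' \<noteq> \<one>\<rbrakk> \<Longrightarrow> rdot b (a \<star> a') = a \<star> a'"
    and pent7: "\<lbrakk>a \<in> carrier A; a' \<in> carrier A\<rbrakk> \<Longrightarrow> bexp b (a \<star> a') = bexp b a"
    and pent8: "\<lbrakk>\<exists>x\<in>carrier A. rexp b x \<noteq> x; a \<in> carrier A; a' \<in> carrier A\<rbrakk>
          \<Longrightarrow> rexp b a \<otimes> a' = a' \<otimes> rexp b a"
    and pent8': "\<lbrakk>\<exists>x\<in>carrier A. lexp b x \<noteq> x; a \<in> carrier A; a' \<in> carrier A\<rbrakk>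
          \<Longrightarrow> lexp b a \<otimes> a' = a' \<otimes> lexp b a"
    and pent9: "\<lbrakk>a \<in> carrier A; a' \<in> carrier A\<rbrakk> \<Longrightarrow> a \<star> rexp b a' = a \<star> a'"
    and pent9': "\<lbrakk>a \<in> carrier A; a' \<in> carrier A\<rbrakk> \<Longrightarrow> a \<star> lexp b a' = a \<star> a'"
    and pent10: "\<lbrakk>a \<in> carrier A; a' \<in> carrier A; a' \<noteq> \<one>\<rbrakk> \<Longrightarrow> a \<star> bexp b a' = a"
    and pent11: "a \<in> carrier A \<Longrightarrow> rdot b (ldot b a) = a"
    and pent11': "a \<in> carrier A \<Longrightarrow> ldot b (rdot b a) = a"
    and pent12: "a \<in> carrier A \<Longrightarrow> lexp b (rexp b a) = a"
    and pent12': "a \<in> carrier A \<Longrightarrow> rexp b (lexp b a) = a"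

definition Pentact :: "('a, 'm) gact_scheme \<Rightarrow> 'a quintuple set" where
  "Pentact A = {b. pentaction A b}"

definition pent_add ::
    "('a, 'm) gact_scheme \<Rightarrow> 'a quintuple \<Rightarrow> 'a quintuple \<Rightarrow> 'a quintuple" where
  "pent_add A b b' =
     \<lparr>ldot = (\<lambda>a\<in>carrier A. ldot b (ldot b' a)),
      rdot = (\<lambda>a\<in>carrier A. rdot b' (rdot b a)),
      rexp = (\<lambda>a\<in>carrier A. rexp b' (rexp b a)),
      lexp = (\<lambda>a\<in>carrier A. lexp b (lexp b' a)),
      bexp = (\<lambda>a\<in>carrier A. bexp b a \<otimes>\<^bsub>A\<^esub> ldot b (bexp b' a))\<rparr>"

definition pent_act ::
    "('a, 'm) gact_scheme \<Rightarrow> 'a quintuple \<Rightarrow> 'a quintuple \<Rightarrow> 'a quintuple" where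
  "pent_act A b b' =
     \<lparr>ldot = (\<lambda>a\<in>carrier A. a),
      rdot = (\<lambda>a\<in>carrier A. a),
      rexp = (\<lambda>a\<in>carrier A. rexp b a),
      lexp = (\<lambda>a\<in>carrier A. lexp b a),
      bexp = (\<lambda>a\<in>carrier A. rexp b' (bexp b (ldot b' a)))\<rparr>"

definition pent_zero :: "('a, 'm) gact_scheme \<Rightarrow> 'a quintuple" where
  "pent_zero A =
     \<lparr>ldot = (\<lambda>a\<in>carrier A. a),
      rdot = (\<lambda>a\<in>carrier A. a),
      rexp = (\<lambda>a\<in>carrier A. a),
      lexp = (\<lambda>a\<in>carrier A. a),
      bexp = (\<lambda>a\<in>carrier A. \<one>\<^bsub>A\<^esub>)\<rparr>"

definition Pentact_gact :: "('a, 'm) gact_scheme \<Rightarrow> 'a quintuple gact" where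
  "Pentact_gact A =
     \<lparr>carrier = Pentact A, mult = pent_add A, one = pent_zero A, act = pent_act A\<rparr>"

definition wStab :: "('a, 'm) gact_scheme \<Rightarrow> 'a set" where
  "wStab A =
     {bexp b (bexp b' a) | b b' a. b \<in> Pentact A \<and> b' \<in> Pentact A \<and> a \<in> carrier A}
   \<union> {bexp b (rexp b' a) \<otimes>\<^bsub>A\<^esub> inv\<^bsub>A\<^esub> bexp b a | b b' a.
        b \<in> Pentact A \<and> b' \<in> Pentact A \<and> a \<in> carrier A}
   \<union> {rexp (pent_add A b b') a \<otimes>\<^bsub>A\<^esub> inv\<^bsub>A\<^esub> rexp (pent_add A b' b) a | b b' a.
        b \<in> Pentact A \<and> b' \<in> Pentact A \<and> a \<in> carrier A}"

end

theory Submission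
  imports Defs
begin

text \<open>
  Each \<open>y\<close> acts bijectively, so if some \<open>y \<noteq> \<one>\<close> exists then every \<open>x\<close> has the form
  \<open>x' \<star> y\<close>.  Hence \<open>A\<close> is commutative by the reducedness axiom, and every pentaction has trivial
  dot operations by axioms 6 and 6'.  A pentaction thus amounts to a bijection \<open>rexp\<close>, its inverse
  \<open>lexp\<close> and a map \<open>bexp\<close>; of the weak stabilizer, only the commutation of the maps \<open>rexp\<close> is
  needed.
\<close>

lemma Pentact_gact_simps [simp]:
  "carrier (Pentact_gact A) = Pentact A"
  "mult (Pentact_gact A) = pent_add A"
  "one (Pentact_gact A) = pent_zero A"
  "act (Pentact_gact A) = pent_act A"
  by (simp_all add: Pentact_gact_def)

section \<open>Consequences of reducedness: bijective actions and commutativity\<close>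

context reduced_group_with_action
begin

lemma exists_act_eq:
  assumes "x \<in> carrier G" "y \<in> carrier G"
  obtains x' where "x' \<in> carrier G" "x = x' \<star> y"
proof
  show "x \<star> inv y \<in> carrier G"
    using assms by (simp add: act_closed)
  show "x = (x \<star> inv y) \<star> y"
    using assms by (simp add: act_act [symmetric] act_one)
qed

lemma commute:
  assumes "x \<in> carrier G" "z \<in> carrier G"
  shows "x \<otimes> z = z \<otimes> x"
proof (cases "x = \<one>")
  case False
  \<comment> \<open>\<open>x\<close> itself serves as the nontrivial exponent that
    \<open>act_central\<close> asks for.\<close>
  obtain x' where "x' \<in> carrier G" "x = x' \<star> x"
    using exists_act_eq assms(1) by blast
  then show ?thesis
    using act_central [of x' x z] assms False by simp
qed (use assms in simp)

sublocale comm_group G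
  by (rule group_comm_groupI) (rule commute)

lemma one_act:
  assumes "y \<in> carrier G"
  shows "\<one> \<star> y = \<one>"
proof -
  have "(\<one> \<star> y) \<otimes> (\<one> \<star> y) = \<one> \<star> y"
    using act_mult [of \<one> \<one> y] assms by simp
  then show ?thesis
    using assms act_closed [of \<one> y] r_cancel_one by simp
qed

lemma inv_act:
  assumes "x \<in> carrier G" "y \<in> carrier G"
  shows "(inv x) \<star> y = inv (x \<star> y)"
proof -
  have "((inv x) \<star> y) \<otimes> (x \<star> y) = \<one>"
    using act_mult [of "inv x" x y] assms by (simp add: one_act)
  then show ?thesis
    using assms by (metis act_closed inv_closed inv_equality)
qed

section \<open>Pentactions over a reduced group with action: trivial dot operations\<close>

context
  fixes b
  assumes b: "pentaction G b"
begin

lemma rexp_closed: "a \<in> carrier G \<Longrightarrow> rexp b a \<in> carrier G"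
  using pentaction.rexp_fun [OF b] by auto

lemma lexp_closed: "a \<in> carrier G \<Longrightarrow> lexp b a \<in> carrier G"
  using pentaction.lexp_fun [OF b] by auto

lemma bexp_closed: "a \<in> carrier G \<Longrightarrow> bexp b a \<in> carrier G"
  using pentaction.bexp_fun [OF b] by auto

text \<open>A nontrivial \<open>y\<close> gives \<open>a = x' \<star> y\<close>, and
  \<open>pent6\<close> says that \<open>ldot b\<close> fixes such elements.\<close>

lemma ldot_trivial:
  assumes "a \<in> carrier G"
  shows "ldot b a = a"
proof (cases "\<exists>y\<in>carrier G. y \<noteq> \<one>")
  case True
  then obtain y where "y \<in> carrier G" "y \<noteq> \<one>" by blast
  then show ?thesis
    using assms exists_act_eq pentaction.pent6 [OF b] by metis
next
  \<comment> \<open>The carrier is now \<open>{\<one>}\<close>, so closure of \<open>ldot b\<close>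
    decides the claim.\<close>
  case False
  then show ?thesis
    using assms pentaction.ldot_fun [OF b] by (metis PiE_mem)
qed

lemma rdot_trivial: "a \<in> carrier G \<Longrightarrow> rdot b a = a"
  using ldot_trivial pentaction.pent11 [OF b] by metis

lemma rexp_act:
  "\<lbrakk>a \<in> carrier G; a' \<in> carrier G\<rbrakk> \<Longrightarrow> rexp b (a \<star> a') = rexp b a \<star> a'"
  using pentaction.pent5 [OF b] by (simp add: ldot_trivial)

lemma lexp_act:
  assumes "a \<in> carrier G" "a' \<in> carrier G"
  shows "lexp b (a \<star> a') = lexp b a \<star> a'"
  \<comment> \<open>Left exponents are encoded through inverses, so the axiom is taken at
    \<open>inv a'\<close>.\<close>
  using assms pentaction.pent5' [OF b, of a "inv a'"] by (simp add: rdot_trivial)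

lemma ldot_eq: "ldot b = (\<lambda>a\<in>carrier G. a)"
  by (rule PiE_ext [OF pentaction.ldot_fun [OF b]])
    (auto simp: ldot_trivial)

lemma rdot_eq: "rdot b = (\<lambda>a\<in>carrier G. a)"
  by (rule PiE_ext [OF pentaction.rdot_fun [OF b]])
    (auto simp: rdot_trivial)

end

section \<open>Construction of pentactions: criterion, sum, action, zero and negative\<close>

lemmas pent_closed = rexp_closed lexp_closed bexp_closed
lemmas pent_trivial = ldot_trivial rdot_trivial

text \<open>The laws for \<open>lexp\<close> follow from those for its inverse \<open>rexp\<close>,
  the laws for the dots hold for identity maps, and \<open>pent8\<close> and \<open>pent8'\<close>
  are commutativity.\<close>

lemma pentactionI:
  assumes ldot: "ldot b = (\<lambda>a\<in>carrier G. a)" and rdot: "rdot b = (\<lambda>a\<in>carrier G. a)"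
    and rexp_fun: "rexp b \<in> carrier G \<rightarrow>\<^sub>E carrier G"
    and lexp_fun: "lexp b \<in> carrier G \<rightarrow>\<^sub>E carrier G"
    and bexp_fun: "bexp b \<in> carrier G \<rightarrow>\<^sub>E carrier G"
    and rexp_mult: "\<And>a a'. \<lbrakk>a \<in> carrier G; a' \<in> carrier G\<rbrakk>
          \<Longrightarrow> rexp b (a \<otimes> a') = rexp b a \<otimes> rexp b a'"
    and bexp_mult: "\<And>a a'. \<lbrakk>a \<in> carrier G; a' \<in> carrier G\<rbrakk>
          \<Longrightarrow> bexp b (a \<otimes> a') = (bexp b a \<star> a') \<otimes> bexp b a'"
    and rexp_act: "\<And>a a'. \<lbrakk>a \<in> carrier G; a' \<in> carrier G\<rbrakk>
          \<Longrightarrow> rexp b (a \<star> a') = rexp b a \<star> a'"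
    and bexp_act: "\<And>a a'. \<lbrakk>a \<in> carrier G; a' \<in> carrier G\<rbrakk> \<Longrightarrow> bexp b (a \<star> a') = bexp b a"
    and act_rexp: "\<And>a a'. \<lbrakk>a \<in> carrier G; a' \<in> carrier G\<rbrakk> \<Longrightarrow> a \<star> rexp b a' = a \<star> a'"
    and act_bexp: "\<And>a a'. \<lbrakk>a \<in> carrier G; a' \<in> carrier G; a' \<noteq> \<one>\<rbrakk> \<Longrightarrow> a \<star> bexp b a' = a"
    and lexp_rexp: "\<And>a. a \<in> carrier G \<Longrightarrow> lexp b (rexp b a) = a"
    and rexp_lexp: "\<And>a. a \<in> carrier G \<Longrightarrow> rexp b (lexp b a) = a"
  shows "pentaction G b"
proof -
  have rexp_closed: "rexp b a \<in> carrier G" and lexp_closed: "lexp b a \<in> carrier G"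
    if "a \<in> carrier G" for a
    using that rexp_fun lexp_fun by auto
  have lexp_mult: "lexp b (a \<otimes> a') = lexp b a \<otimes> lexp b a'"
    if "a \<in> carrier G" "a' \<in> carrier G" for a a'
    \<comment> \<open>\<open>lexp_rexp\<close> is applied to the claimed right-hand side, whose
      image under \<open>rexp b\<close> is \<open>a \<otimes> a'\<close>. The next fact is obtained
      in the same way.\<close>
    using that lexp_rexp [of "lexp b a \<otimes> lexp b a'"]
    by (simp add: lexp_closed rexp_mult rexp_lexp)
  have lexp_act: "lexp b (a \<star> a') = lexp b a \<star> a'"
    if "a \<in> carrier G" "a' \<in> carrier G" for a a'
    using that lexp_rexp [of "lexp b a \<star> a'"]
    by (simp add: lexp_closed act_closed rexp_act rexp_lexp)
  have act_lexp: "a \<star> lexp b a' = a \<star> a'"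
    if "a \<in> carrier G" "a' \<in> carrier G" for a a'
    using that act_rexp [of a "lexp b a'"] by (simp add: lexp_closed rexp_lexp)
  show ?thesis
    by unfold_locales
      (simp_all add: ldot rdot rexp_fun lexp_fun bexp_fun rexp_closed lexp_closed act_closed
        rexp_mult lexp_mult bexp_mult rexp_act lexp_act bexp_act act_rexp act_lexp act_bexp
        lexp_rexp rexp_lexp commute)
qed

text \<open>Since \<open>ldot b\<close> is the identity, the twisted sum in \<open>bexp\<close>
  becomes a pointwise product.\<close>

lemma pent_add_simps:
  assumes "pentaction G b" "pentaction G c"
  shows "ldot (pent_add G b c) = (\<lambda>a\<in>carrier G. a)"
    and "rdot (pent_add G b c) = (\<lambda>a\<in>carrier G. a)"
    and "rexp (pent_add G b c) = (\<lambda>a\<in>carrier G. rexp c (rexp b a))"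
    and "lexp (pent_add G b c) = (\<lambda>a\<in>carrier G. lexp b (lexp c a))"
    and "bexp (pent_add G b c) = (\<lambda>a\<in>carrier G. bexp b a \<otimes> bexp c a)"
  using assms by (auto simp: pent_add_def pent_trivial pent_closed restrict_def)

lemma pent_act_simps:
  assumes "pentaction G b" "pentaction G c"
  shows "ldot (pent_act G b c) = (\<lambda>a\<in>carrier G. a)"
    and "rdot (pent_act G b c) = (\<lambda>a\<in>carrier G. a)"
    and "rexp (pent_act G b c) = rexp b"
    and "lexp (pent_act G b c) = lexp b"
    and "bexp (pent_act G b c) = (\<lambda>a\<in>carrier G. rexp c (bexp b a))"
  using assms pentaction.rexp_fun [OF assms(1)] pentaction.lexp_fun [OF assms(1)]
  by (auto simp: pent_act_def pent_trivial PiE_iff extensional_restrict)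

lemma pent_zero_simps:
  "ldot (pent_zero G) = (\<lambda>a\<in>carrier G. a)"
  "rdot (pent_zero G) = (\<lambda>a\<in>carrier G. a)"
  "rexp (pent_zero G) = (\<lambda>a\<in>carrier G. a)"
  "lexp (pent_zero G) = (\<lambda>a\<in>carrier G. a)"
  "bexp (pent_zero G) = (\<lambda>a\<in>carrier G. \<one>)"
  by (simp_all add: pent_zero_def)

lemma pent_zero_pentaction: "pentaction G (pent_zero G)"
  by (rule pentactionI) (auto simp: pent_zero_simps act_closed act_one one_act)

lemma pent_add_pentaction:
  assumes b: "pentaction G b" and c: "pentaction G c"
  shows "pentaction G (pent_add G b c)"
proof (rule pentactionI)
  fix a a' assume a: "a \<in> carrier G" "a' \<in> carrier G"
  show "bexp (pent_add G b c) (a \<otimes> a')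
      = (bexp (pent_add G b c) a \<star> a') \<otimes> bexp (pent_add G b c) a'"
    \<comment> \<open>Both sides have the same four factors after \<open>pent4\<close> and
      \<open>act_mult\<close>; commutativity swaps the middle two.\<close>
    using a m_ac(3) [of "bexp b a'" "bexp c a \<star> a'" "bexp c a'"]
    by (simp add: pent_add_simps b c pentaction.pent4 [OF b] pentaction.pent4 [OF c]
        bexp_closed act_closed act_mult m_assoc)
qed (simp_all add: assms pent_add_simps pent_closed act_closed rexp_act
      pentaction.pent2 [OF b] pentaction.pent2 [OF c]
      pentaction.pent7 [OF b] pentaction.pent7 [OF c]
      pentaction.pent9 [OF b] pentaction.pent9 [OF c]
      pentaction.pent10 [OF b] pentaction.pent10 [OF c] act_act
      pentaction.pent12 [OF b] pentaction.pent12 [OF c]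
      pentaction.pent12' [OF b] pentaction.pent12' [OF c])

text \<open>The new \<open>bexp\<close> is \<open>bexp b\<close> followed by \<open>rexp c\<close>.
  As \<open>rexp c\<close> is a homomorphism compatible with the action, it preserves
  \<open>pent4\<close>; by \<open>pent9\<close> for \<open>c\<close> it does not change how elements
  act, which preserves \<open>pent10\<close>.\<close>

lemma pent_act_pentaction:
  assumes b: "pentaction G b" and c: "pentaction G c"
  shows "pentaction G (pent_act G b c)"
  by (rule pentactionI)
    (simp_all add: assms pent_act_simps pent_closed act_closed rexp_act
      pentaction.rexp_fun [OF b] pentaction.lexp_fun [OF b]
      pentaction.pent2 [OF b] pentaction.pent2 [OF c] pentaction.pent4 [OF b]
      pentaction.pent7 [OF b] pentaction.pent9 [OF b] pentaction.pent9 [OF c]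
      pentaction.pent10 [OF b] pentaction.pent12 [OF b] pentaction.pent12' [OF b])

text \<open>The additive inverse: mutually inverse maps trade places, and \<open>bexp\<close> is
  inverted pointwise because sums are pointwise products there. The restriction keeps it
  extensional.\<close>

definition pent_neg :: "'a quintuple \<Rightarrow> 'a quintuple" where
  "pent_neg b =
     \<lparr>ldot = rdot b, rdot = ldot b, rexp = lexp b, lexp = rexp b,
      bexp = (\<lambda>a\<in>carrier G. inv (bexp b a))\<rparr>"

text \<open>Gives \<open>pent10\<close> for the negative, whose \<open>bexp\<close> takes the values
  \<open>inv (bexp b a)\<close>.\<close>

lemma act_inv_fixed:
  assumes "a \<in> carrier G" "c \<in> carrier G" "a \<star> c = a"
  shows "a \<star> inv c = a"
  using assms act_act [of a c "inv c"] act_one by simp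

lemma pent_neg_pentaction:
  assumes b: "pentaction G b"
  shows "pentaction G (pent_neg b)"
  by (rule pentactionI)
    (simp_all add: pent_neg_def b ldot_eq rdot_eq pent_closed act_closed lexp_act inv_act inv_mult
      pentaction.rexp_fun [OF b] pentaction.lexp_fun [OF b]
      pentaction.pent2' [OF b] pentaction.pent4 [OF b]
      pentaction.pent7 [OF b] pentaction.pent9' [OF b]
      pentaction.pent10 [OF b] act_inv_fixed
      pentaction.pent12 [OF b] pentaction.pent12' [OF b])

section \<open>Group and action axioms for the set of pentactions\<close>

lemma pentact_group: "group (Pentact_gact G)"
proof (rule groupI)
  show "\<one>\<^bsub>Pentact_gact G\<^esub> \<in> carrier (Pentact_gact G)"
    by (simp add: Pentact_def pent_zero_pentaction)
next
  fix b c assume "b \<in> carrier (Pentact_gact G)" "c \<in> carrier (Pentact_gact G)"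
  then show "b \<otimes>\<^bsub>Pentact_gact G\<^esub> c \<in> carrier (Pentact_gact G)"
    by (simp add: Pentact_def pent_add_pentaction)
next
  fix b c d
  assume "b \<in> carrier (Pentact_gact G)" "c \<in> carrier (Pentact_gact G)"
    "d \<in> carrier (Pentact_gact G)"
  then have "pentaction G b" "pentaction G c" "pentaction G d"
    by (simp_all add: Pentact_def)
  then show "b \<otimes>\<^bsub>Pentact_gact G\<^esub> c \<otimes>\<^bsub>Pentact_gact G\<^esub> d
      = b \<otimes>\<^bsub>Pentact_gact G\<^esub> (c \<otimes>\<^bsub>Pentact_gact G\<^esub> d)"
    by (auto intro!: quintuple.equality restrict_ext
        simp: pent_add_simps pent_add_pentaction pent_closed m_assoc)
next
  fix b assume "b \<in> carrier (Pentact_gact G)"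
  then have b: "pentaction G b"
    by (simp add: Pentact_def)
  show "\<one>\<^bsub>Pentact_gact G\<^esub> \<otimes>\<^bsub>Pentact_gact G\<^esub> b = b"
    using pentaction.rexp_fun [OF b] pentaction.lexp_fun [OF b] pentaction.bexp_fun [OF b]
    by (auto intro!: quintuple.equality extensionalityI [of _ "carrier G"]
        simp: b pent_add_simps pent_zero_simps pent_zero_pentaction pent_closed ldot_eq rdot_eq
          PiE_iff)
  have "pent_add G (pent_neg b) b = pent_zero G"
    \<comment> \<open>\<open>pent_neg\<close> stays folded until the sum is evaluated, so that
      \<open>pent_add_simps\<close> can use \<open>pent_neg_pentaction\<close>.\<close>
    by (auto intro!: quintuple.equality restrict_ext
        simp: b pent_add_simps pent_zero_simps pent_neg_pentaction)
      (simp_all add: pent_neg_def b pent_closed pentaction.pent12 [OF b] pentaction.pent12' [OF b])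
  then show "\<exists>c\<in>carrier (Pentact_gact G). c \<otimes>\<^bsub>Pentact_gact G\<^esub> b = \<one>\<^bsub>Pentact_gact G\<^esub>"
    using pent_neg_pentaction [OF b] by (auto simp: Pentact_def)
qed

text \<open>An exponent enters only through its \<open>rexp\<close>, composed with
  \<open>bexp\<close> of the base. Additivity in the base is thus \<open>pent2\<close>, and the law
  for sums of exponents is the composition rule for \<open>rexp\<close>.\<close>

lemma pentact_group_with_action: "group_with_action (Pentact_gact G)"
proof -
  interpret P: group "Pentact_gact G"
    by (rule pentact_group)
  show ?thesis
  proof unfold_locales
    fix b c assume "b \<in> carrier (Pentact_gact G)" "c \<in> carrier (Pentact_gact G)"
    then show "b \<star>\<^bsub>Pentact_gact G\<^esub> c \<in> carrier (Pentact_gact G)"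
      by (simp add: Pentact_def pent_act_pentaction)
  next
    fix b c d
    assume "b \<in> carrier (Pentact_gact G)" "c \<in> carrier (Pentact_gact G)"
      "d \<in> carrier (Pentact_gact G)"
    then have bcd: "pentaction G b" "pentaction G c" "pentaction G d"
      by (simp_all add: Pentact_def)
    then show "(b \<otimes>\<^bsub>Pentact_gact G\<^esub> c) \<star>\<^bsub>Pentact_gact G\<^esub> d
        = (b \<star>\<^bsub>Pentact_gact G\<^esub> d) \<otimes>\<^bsub>Pentact_gact G\<^esub> (c \<star>\<^bsub>Pentact_gact G\<^esub> d)"
      by (auto intro!: quintuple.equality restrict_ext
          simp: pent_add_simps pent_act_simps pent_add_pentaction pent_act_pentaction pent_closed
            pentaction.pent2)
    show "b \<star>\<^bsub>Pentact_gact G\<^esub> (c \<otimes>\<^bsub>Pentact_gact G\<^esub> d)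
        = b \<star>\<^bsub>Pentact_gact G\<^esub> c \<star>\<^bsub>Pentact_gact G\<^esub> d"
      using bcd by (auto intro!: quintuple.equality restrict_ext
          simp: pent_add_simps pent_act_simps pent_add_pentaction pent_act_pentaction pent_closed)
  next
    fix b assume "b \<in> carrier (Pentact_gact G)"
    then have b: "pentaction G b"
      by (simp add: Pentact_def)
    show "b \<star>\<^bsub>Pentact_gact G\<^esub> \<one>\<^bsub>Pentact_gact G\<^esub> = b"
      using pentaction.rexp_fun [OF b] pentaction.lexp_fun [OF b] pentaction.bexp_fun [OF b]
      by (auto intro!: quintuple.equality extensionalityI [of _ "carrier G"]
          simp: b pent_act_simps pent_zero_simps pent_zero_pentaction pent_closed ldot_eq rdot_eq
            PiE_iff)
  qed
qed

section \<open>Reducedness from the weak stabilizer\<close>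

lemma rexp_commute:
  assumes "wStab G = {\<one>}" and b: "pentaction G b" and c: "pentaction G c"
    and a: "a \<in> carrier G"
  shows "rexp b (rexp c a) = rexp c (rexp b a)"
proof -
  \<comment> \<open>An element of the third kind in \<open>wStab\<close>. The summands are swapped
    because the right exponent of a sum applies the first summand first.\<close>
  have "rexp (pent_add G c b) a \<otimes> inv (rexp (pent_add G b c) a) \<in> wStab G"
    unfolding wStab_def Pentact_def using b c a by blast
  then have "rexp b (rexp c a) \<otimes> inv (rexp c (rexp b a)) = \<one>"
    using assms by (simp add: pent_add_simps)
  then show ?thesis
    using a b c by (metis inv_equality inv_inv inv_closed rexp_closed)
qed

text \<open>Inverses of commuting bijections commute.\<close>

lemma lexp_commute:
  assumes "wStab G = {\<one>}" and b: "pentaction G b" and c: "pentaction G c"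
    and a: "a \<in> carrier G"
  shows "lexp b (lexp c a) = lexp c (lexp b a)"
proof -
  define z where "z = lexp b (lexp c a)"
  have z: "z \<in> carrier G"
    using a b c by (simp add: z_def lexp_closed)
  have "rexp b (rexp c z) = rexp c (rexp b z)"
    by (rule rexp_commute [OF assms(1) b c z])
  also have "\<dots> = a"
    by (simp add: z_def a b c lexp_closed pentaction.pent12' [OF b] pentaction.pent12' [OF c])
  finally have "a = rexp b (rexp c z)" ..
  then show ?thesis
    unfolding z_def [symmetric]
    using z b c by (simp add: rexp_closed pentaction.pent12 [OF b] pentaction.pent12 [OF c])
qed

text \<open>Acting on a pentaction leaves its \<open>rexp\<close> alone, and only
  \<open>rexp\<close> of an exponent matters; this gives \<open>act_reduced\<close>. For
  \<open>act_central\<close>, the exponent maps commute by the two preceding lemmas and the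
  \<open>bexp\<close> parts by commutativity of \<open>G\<close>.\<close>

lemma pentact_reduced:
  assumes stab: "wStab G = {\<one>}"
  shows "reduced_group_with_action (Pentact_gact G)"
proof -
  interpret P: group_with_action "Pentact_gact G"
    by (rule pentact_group_with_action)
  show ?thesis
  proof unfold_locales
    fix b c d
    assume "b \<in> carrier (Pentact_gact G)" "c \<in> carrier (Pentact_gact G)"
      "d \<in> carrier (Pentact_gact G)"
    then have bcd: "pentaction G b" "pentaction G c" "pentaction G d"
      by (simp_all add: Pentact_def)
    then show "b \<star>\<^bsub>Pentact_gact G\<^esub> (c \<star>\<^bsub>Pentact_gact G\<^esub> d) = b \<star>\<^bsub>Pentact_gact G\<^esub> c"
      by (auto intro!: quintuple.equality simp: pent_act_simps pent_act_pentaction)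
    show "(b \<star>\<^bsub>Pentact_gact G\<^esub> c) \<otimes>\<^bsub>Pentact_gact G\<^esub> d
        = d \<otimes>\<^bsub>Pentact_gact G\<^esub> (b \<star>\<^bsub>Pentact_gact G\<^esub> c)"
      using bcd by (auto intro!: quintuple.equality restrict_ext
          simp: pent_add_simps pent_act_simps pent_act_pentaction pent_closed m_comm
            rexp_commute [OF stab, of b d] lexp_commute [OF stab, of b d])
  qed
qed

end

theorem theorem3p14:
  fixes A :: "('a, 'm) gact_scheme"
  assumes "reduced_group_with_action A"
    and "perfect A"
    and "wStab A = {\<one>\<^bsub>A\<^esub>}"
  shows "reduced_group_with_action (Pentact_gact A)"
  using reduced_group_with_action.pentact_reduced [OF assms(1,3)] .

end
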